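(* One has $$\mathcal{T}_{\mathbb{R}}(\Omega_{5/2})\ge\frac{559+80\sqrt{42}}{506}>2.$$
   Context: For $\lambda\ge 0$ let $\Omega_\lambda=(-1,1)\cup(\lambda-1,\lambda+1)\cup(-\lambda-1,-\lambda+1)\subset\mathbb{R}$; $\Omega_{5/2}$ is the case $\lambda=5/2$. A function $f:\mathbb{R}\to\mathbb{C}$ is positive definite if $\sum_{j,k=1}^m z_j\overline{z_k}f(x_j-x_k)\ge 0$ for all finite choices of $x_1,\dots,x_m\in\mathbb{R}$ and $z_1,\dots,z_m\in\mathbb{C}$. For an open bounded set $\Omega\subset\mathbb{R}$ with $\Omega=-\Omega$ and $0\in\Omega$, the Turán constant is $$\mathcal{T}_{\mathbb{R}}(\Omega)=\sup\left\{\int_{\mathbb{R}}f(x)\,dx: f\in C(\mathbb{R}),\ f \text{ positive definite},\ f(0)=1,\ \operatorname{supp} f\subset\Omega\right\},$$ where $\operatorname{supp} f$ is the closed support of $f$ (the integrals in question are automatically real). *)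

theory Defs
  imports "HOL-Analysis.Analysis"
begin

definition positive_definite :: "(real \<Rightarrow> complex) \<Rightarrow> bool" where
  "positive_definite f \<longleftrightarrow>
     (\<forall>(m::nat) (x :: nat \<Rightarrow> real) (z :: nat \<Rightarrow> complex).
        (\<Sum>j<m. \<Sum>k<m. z j * cnj (z k) * f (x j - x k)) \<in> \<real>\<^sub>\<ge>\<^sub>0)"

definition closed_support :: "(real \<Rightarrow> complex) \<Rightarrow> real set" where
  "closed_support f = closure {x. f x \<noteq> 0}"

definition turan_class :: "real set \<Rightarrow> (real \<Rightarrow> complex) set" where
  "turan_class \<Omega> =
     {f. continuous_on UNIV f \<and> positive_definite f \<and> f 0 = 1 \<and> closed_support f \<subseteq> \<Omega>}"

text \<open>
  Intended for open bounded \<open>\<Omega>\<close> with \<open>\<Omega> = - \<Omega>\<close> and \<open>0 \<in> \<Omega>\<close>. Boundedness makes the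
  closed support compact, so each integrand is integrable; a positive definite function satisfies
  \<open>f (- x) = cnj (f x)\<close>, so each integral is real and \<open>Re\<close> discards nothing. The supremum is
  taken in the extended reals, so that it is the genuine least upper bound with no boundedness
  side condition.
\<close>

definition turan_constant :: "real set \<Rightarrow> ereal" where
  "turan_constant \<Omega> = (SUP f\<in>turan_class \<Omega>. ereal (Re (LINT x|lborel. f x)))"

definition Omega :: "real \<Rightarrow> real set" where
  "Omega l = {-1<..<1} \<union> {l - 1<..<l + 1} \<union> {- l - 1<..<- l + 1}"

end

theory Submission
  imports Defs
begin

text \<open>
  The lower bound comes from one explicit function: the normalised autocorrelation of the step
  function \<open>h = (\<Sum>i<7. a\<^sub>i \<cdot> 1\<^bsub>[i/2, i/2 + w]\<^esub>)\<close>. An autocorrelation is positive definite,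
  since its quadratic form is the integral of \<open>\<bar>\<Sum>j. z\<^sub>j h(y + x\<^sub>j)\<bar>\<^sup>2\<close>. Here it is a sum of tents of half-width
  \<open>w\<close> centred at the multiples \<open>k/2\<close> with \<open>\<bar>k\<bar> \<le> 6\<close>, the tent at \<open>k/2\<close> carrying the correlation of the
  sequence \<open>a\<close> at lag \<open>k\<close>. If \<open>w < 1/2\<close>, the tents at \<open>0\<close>, \<open>\<plusminus>1/2\<close>, \<open>\<plusminus>2\<close>, \<open>\<plusminus>5/2\<close>, \<open>\<plusminus>3\<close> lie in
  \<open>\<Omega>\<close> (\<open>5/2\<close>), while those at \<open>\<plusminus>1\<close> and \<open>\<plusminus>3/2\<close> do not. So \<open>a\<close> must have zero correlation at the
  lags \<open>2\<close> and \<open>3\<close>. The integral is then \<open>w (\<Sum>a\<^sub>i)\<^sup>2 / \<Sum>a\<^sub>i\<^sup>2\<close>.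

  For a palindromic sequence \<open>(1, t, u, v, u, t, 1)\<close> the two conditions read \<open>v = - t u\<close> and
  \<open>2 u + 2 t v + u\<^sup>2 = 0\<close>, so \<open>u = 2 (t\<^sup>2 - 1)\<close> gives a one-parameter family of rational solutions. The
  quotient \<open>(\<Sum>a\<^sub>i)\<^sup>2 / \<Sum>a\<^sub>i\<^sup>2\<close> is about \<open>4.27\<close> near its maximum, which is attained close to
  \<open>t = 1.07\<close>. The nearby value \<open>t = 15/14\<close> has small height, and with \<open>w = 499/1000\<close> the integral
  exceeds \<open>2.130\<close>, whereas the claimed bound is below \<open>2.1295\<close>. A half-width strictly below \<open>1/2\<close> keeps the
  closed support inside the open set.

  Positive definiteness is \<open>positive_definite_tent_autocorrelation\<close>, the vanishing of the two forbidden
  lags is \<open>weights_autocorrelation\<close>, and the value of the integral is \<open>integral_test_fun\<close>.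
\<close>

definition tent :: "real \<Rightarrow> real \<Rightarrow> real" where
  "tent w x = max 0 (w - \<bar>x\<bar>)"

lemma tent_zero_iff: "tent w x = 0 \<longleftrightarrow> w \<le> \<bar>x\<bar>"
  by (auto simp: tent_def)

lemma continuous_on_tent [continuous_intros]:
  "continuous_on S g \<Longrightarrow> continuous_on S (\<lambda>x. tent w (g x))"
  unfolding tent_def by (intro continuous_intros)

text \<open>
  A tent is the autocorrelation of the indicator of an interval of length \<open>w\<close>. This turns values of
  the tent into inner products of translated indicators, which is what makes it positive definite.
\<close>

lemma tent_overlap:
  assumes "0 \<le> w"
  shows "has_bochner_integral lborel
           (\<lambda>y. indicator {u..u + w} y * indicator {v..v + w} y) (tent w (u - v))"
proof -
  have "(\<lambda>y::real. indicator {u..u + w} y * indicator {v..v + w} y :: real)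
      = indicator {max u v..min u v + w}"
    by (auto simp: indicator_def fun_eq_iff)
  moreover have "has_bochner_integral lborel (indicator {max u v..min u v + w})
      (measure lborel {max u v..min u v + w})"
    by (intro has_bochner_integral_real_indicator) (auto simp: emeasure_lborel_Icc_eq)
  moreover have "measure lborel {max u v..min u v + w} = tent w (u - v)"
    using assms by (auto simp: tent_def measure_def emeasure_lborel_Icc_eq max_def min_def)
  ultimately show ?thesis by simp
qed

text \<open>
  The double sum is the integral of \<open>\<bar>\<Sum>p. z\<^sub>p 1\<^bsub>[x\<^sub>p, x\<^sub>p + w]\<^esub>\<bar>\<^sup>2\<close>. The index set is arbitrary so that
  it can later be a set of pairs (sample point, shift).
\<close>

lemma tent_gram_nonneg:
  fixes z :: "'i \<Rightarrow> complex"
  assumes "0 \<le> w"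
  shows "(\<Sum>p\<in>I. \<Sum>q\<in>I. z p * cnj (z q) * of_real (tent w (x p - x q))) \<in> \<real>\<^sub>\<ge>\<^sub>0"
proof -
  let ?b = "\<lambda>p y. indicator {x p..x p + w} y :: real"
  let ?S = "\<lambda>y. \<Sum>p\<in>I. z p * of_real (?b p y)"
  have "has_bochner_integral lborel
      (\<lambda>y. \<Sum>p\<in>I. \<Sum>q\<in>I. (z p * cnj (z q)) * of_real (?b p y * ?b q y))
      (\<Sum>p\<in>I. \<Sum>q\<in>I. z p * cnj (z q) * of_real (tent w (x p - x q)))"
    by (intro has_bochner_integral_sum has_bochner_integral_mult_right
        has_bochner_integral_of_real tent_overlap assms)
  moreover have "(\<lambda>y. \<Sum>p\<in>I. \<Sum>q\<in>I. (z p * cnj (z q)) * of_real (?b p y * ?b q y))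
      = (\<lambda>y. of_real ((cmod (?S y))\<^sup>2))"
    unfolding complex_norm_square
    by (simp add: sum_product cnj_sum mult_ac fun_eq_iff)
  ultimately have "has_bochner_integral lborel (\<lambda>y. complex_of_real ((cmod (?S y))\<^sup>2))
      (\<Sum>p\<in>I. \<Sum>q\<in>I. z p * cnj (z q) * of_real (tent w (x p - x q)))"
    by (simp only:)
  from has_bochner_integral_integral_eq[OF this]
  have "(\<Sum>p\<in>I. \<Sum>q\<in>I. z p * cnj (z q) * of_real (tent w (x p - x q)))
      = of_real (LINT y|lborel. (cmod (?S y))\<^sup>2)"
    by (simp only: integral_complex_of_real)
  then show ?thesis
    by (simp only: nonneg_Reals_of_real_iff) (rule integral_nonneg_AE, simp)
qed

lemma has_bochner_integral_tent:
  assumes "0 \<le> w"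
  shows "has_bochner_integral lborel (\<lambda>x. tent w (x - c)) (w\<^sup>2)"
proof -
  have 1: "has_bochner_integral lborel (\<lambda>x. (w + x) * indicator {-w..0} x) (w\<^sup>2 / 2)"
  proof -
    have "has_bochner_integral lborel (\<lambda>x. (w + x) * indicator {-w..0} x)
       ((w * 0 + 0\<^sup>2 / 2) - (w * (-w) + (-w)\<^sup>2 / 2))"
      using assms by (intro has_bochner_integral_FTC_Icc_nonneg)
        (auto intro!: derivative_eq_intros continuous_intros)
    then show ?thesis by (simp add: power2_eq_square)
  qed
  have 2: "has_bochner_integral lborel (\<lambda>x. (w - x) * indicator {0..w} x) (w\<^sup>2 / 2)"
  proof -
    have "has_bochner_integral lborel (\<lambda>x. (w - x) * indicator {0..w} x)
       ((w * w - w\<^sup>2 / 2) - (w * 0 - 0\<^sup>2 / 2))"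
      using assms by (intro has_bochner_integral_FTC_Icc_nonneg)
        (auto intro!: derivative_eq_intros continuous_intros)
    then show ?thesis by (simp add: power2_eq_square)
  qed
  have "has_bochner_integral lborel (tent w) (w\<^sup>2)"
  proof -
    have "has_bochner_integral lborel
       (\<lambda>x. (w + x) * indicator {-w..0} x + (w - x) * indicator {0..w} x) (w\<^sup>2)"
      using has_bochner_integral_add[OF 1 2] by simp
    \<comment> \<open>The two halves overlap at \<open>0\<close>, so the identity fails at that single point.\<close>
    moreover have "AE x in lborel. (w + x) * indicator {-w..0} x + (w - x) * indicator {0..w} x = tent w x"
      using AE_lborel_singleton[of 0]
      by eventually_elim (auto simp: tent_def indicator_def)
    ultimately show ?thesis
      by (subst (asm) has_bochner_integral_cong_AE)
         (auto simp: tent_def[abs_def])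
  qed
  then show ?thesis
    using lborel_has_bochner_integral_real_affine_iff[of 1 "tent w" "w\<^sup>2" "- c"] by simp
qed

text \<open>
  Shifting the points turns the quadratic form of the autocorrelation into that of a single tent,
  taken at the points \<open>x\<^sub>j - s\<^sub>i\<close> with the coefficients \<open>z\<^sub>j a\<^sub>i\<close>.
\<close>

lemma positive_definite_tent_autocorrelation:
  fixes a s :: "nat \<Rightarrow> real"
  assumes "0 \<le> w" "0 \<le> C"
  shows "positive_definite
    (\<lambda>x. of_real (C * (\<Sum>i<n. \<Sum>j<n. a i * a j * tent w (x - (s i - s j)))))"
  unfolding positive_definite_def
proof (intro allI)
  fix m :: nat and x :: "nat \<Rightarrow> real" and z :: "nat \<Rightarrow> complex"
  let ?I = "{..<m} \<times> {..<n}"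
  let ?z = "\<lambda>p. z (fst p) * of_real (a (snd p))"
  let ?x = "\<lambda>p. x (fst p) - s (snd p)"
  let ?G = "\<Sum>p\<in>?I. \<Sum>q\<in>?I. ?z p * cnj (?z q) * of_real (tent w (?x p - ?x q))"
  let ?t = "\<lambda>j i k l. z j * cnj (z k) * of_real (a i * a l * tent w (x j - x k - (s i - s l)))"
  have cart: "(\<Sum>j<m. \<Sum>i<n. h j i) = (\<Sum>p\<in>?I. h (fst p) (snd p))"
    for h :: "nat \<Rightarrow> nat \<Rightarrow> complex"
    by (simp add: sum.cartesian_product case_prod_unfold)
  have "(\<Sum>j<m. \<Sum>k<m. z j * cnj (z k) *
        of_real (C * (\<Sum>i<n. \<Sum>l<n. a i * a l * tent w (x j - x k - (s i - s l)))))
      = of_real C * (\<Sum>j<m. \<Sum>k<m. \<Sum>i<n. \<Sum>l<n. ?t j i k l)"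
    by (simp add: sum_distrib_left mult_ac)
  also have "(\<Sum>j<m. \<Sum>k<m. \<Sum>i<n. \<Sum>l<n. ?t j i k l) = (\<Sum>j<m. \<Sum>i<n. \<Sum>k<m. \<Sum>l<n. ?t j i k l)"
    by (rule sum.cong[OF refl]) (rule sum.swap)
  also have "\<dots> = (\<Sum>p\<in>?I. \<Sum>q\<in>?I. ?t (fst p) (snd p) (fst q) (snd q))"
    by (simp only: cart)
  also have "\<dots> = ?G"
    by (intro sum.cong refl) (simp add: algebra_simps)
  finally show "(\<Sum>j<m. \<Sum>k<m. z j * cnj (z k) *
        of_real (C * (\<Sum>i<n. \<Sum>l<n. a i * a l * tent w (x j - x k - (s i - s l))))) \<in> \<real>\<^sub>\<ge>\<^sub>0"
    using assms by (simp only: nonneg_Reals_mult_I tent_gram_nonneg nonneg_Reals_of_real_iff)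
qed

text \<open>
  The sequence \<open>(1, t, 2 (t\<^sup>2 - 1), -2 t (t\<^sup>2 - 1), \<dots>)\<close> at \<open>t = 15/14\<close>, multiplied by \<open>1372\<close> to clear
  denominators.
\<close>

definition weights :: "real list" where
  "weights = [1372, 1470, 406, -435, 406, 1470, 1372]"

definition w0 :: real where "w0 = 499 / 1000"

text \<open>The number \<open>8605465\<close> is the sum of the squares of the weights; it normalises the value at \<open>0\<close>.\<close>

definition test_fun :: "real \<Rightarrow> real" where
  "test_fun x = 1 / (8605465 * w0) *
     (\<Sum>i<7. \<Sum>j<7. weights ! i * weights ! j * tent w0 (x - (real i / 2 - real j / 2)))"

lemma sum_lessThan_7:
  fixes g :: "nat \<Rightarrow> real"
  shows "(\<Sum>i<7. g i) = g 0 + g 1 + g 2 + g 3 + g 4 + g 5 + g 6"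
  by (simp add: eval_nat_numeral)

lemma weights_nth:
  "weights ! 0 = 1372" "weights ! 1 = 1470" "weights ! 2 = 406" "weights ! 3 = -435"
  "weights ! 4 = 406" "weights ! 5 = 1470" "weights ! 6 = 1372"
  by (simp_all add: weights_def)

text \<open>
  No terms at \<open>\<plusminus>1\<close> and \<open>\<plusminus>3/2\<close> appear: the correlations at the lags \<open>2\<close> and \<open>3\<close> cancel exactly, by
  the choice of the weights.
\<close>

lemma weights_autocorrelation:
  "(\<Sum>i<7. \<Sum>j<7. weights ! i * weights ! j * g (x - (real i / 2 - real j / 2))) =
     8605465 * g x
     + 4874100 * (g (x - 1/2) + g (x + 1/2))
     + 3274964 * (g (x - 2) + g (x + 2))
     + 4033680 * (g (x - 5/2) + g (x + 5/2))
     + 1882384 * (g (x - 3) + g (x + 3))"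
  unfolding sum_lessThan_7 weights_nth by simp

lemma test_fun_lags:
  "test_fun x = 1 / (8605465 * w0) *
    (8605465 * tent w0 x
     + 4874100 * (tent w0 (x - 1/2) + tent w0 (x + 1/2))
     + 3274964 * (tent w0 (x - 2) + tent w0 (x + 2))
     + 4033680 * (tent w0 (x - 5/2) + tent w0 (x + 5/2))
     + 1882384 * (tent w0 (x - 3) + tent w0 (x + 3)))"
  unfolding test_fun_def weights_autocorrelation[of "tent w0"] ..

lemma closed_support_test_fun: "closed_support (\<lambda>x. of_real (test_fun x)) \<subseteq> Omega (5/2)"
proof -
  let ?K = "{-(1/2 + w0)..1/2 + w0} \<union> {2 - w0..3 + w0} \<union> {-3 - w0..-2 + w0}"
  have "x \<in> ?K" if "test_fun x \<noteq> 0" for x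
  proof (rule ccontr)
    assume "x \<notin> ?K"
    then have "tent w0 x = 0" "tent w0 (x - 1/2) = 0" "tent w0 (x + 1/2) = 0"
      "tent w0 (x - 2) = 0" "tent w0 (x + 2) = 0" "tent w0 (x - 5/2) = 0" "tent w0 (x + 5/2) = 0"
      "tent w0 (x - 3) = 0" "tent w0 (x + 3) = 0"
      unfolding tent_zero_iff by (auto simp: w0_def)
    with that show False by (simp add: test_fun_lags)
  qed
  then have "{x. complex_of_real (test_fun x) \<noteq> 0} \<subseteq> ?K"
    unfolding of_real_eq_0_iff by blast
  moreover have "closed ?K" by (intro closed_Un closed_atLeastAtMost)
  ultimately have "closed_support (\<lambda>x. of_real (test_fun x)) \<subseteq> ?K"
    unfolding closed_support_def by (rule closure_minimal)
  also have "?K \<subseteq> Omega (5/2)" by (auto simp: Omega_def w0_def)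
  finally show ?thesis .
qed

lemma test_fun_in_turan_class: "(\<lambda>x. of_real (test_fun x)) \<in> turan_class (Omega (5/2))"
  unfolding turan_class_def
proof (intro CollectI conjI closed_support_test_fun)
  show "continuous_on UNIV (\<lambda>x. complex_of_real (test_fun x))"
    unfolding test_fun_def by (intro continuous_intros)
  show "positive_definite (\<lambda>x. of_real (test_fun x))"
    unfolding test_fun_def
    by (intro positive_definite_tent_autocorrelation) (auto simp: w0_def)
  show "complex_of_real (test_fun 0) = 1"
    by (simp add: test_fun_lags tent_def w0_def)
qed

text \<open>
  All translates of the tent have the same integral \<open>w\<^sup>2\<close>, so the double sum factors through
  \<open>(\<Sum>a\<^sub>i)\<^sup>2 = 6061\<^sup>2 = 36735721\<close>.
\<close>

lemma integral_test_fun: "(LINT x|lborel. test_fun x) = w0 * 36735721 / 8605465"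
proof -
  have tent: "has_bochner_integral lborel (\<lambda>x. tent w0 (x - c)) (w0\<^sup>2)" for c
    by (rule has_bochner_integral_tent) (simp add: w0_def)
  have "has_bochner_integral lborel test_fun (1 / (8605465 * w0) *
     (\<Sum>i<7. \<Sum>j<7. weights ! i * weights ! j * w0\<^sup>2))"
    unfolding test_fun_def
    by (intro has_bochner_integral_sum has_bochner_integral_mult_right tent)
  moreover have "(\<Sum>i<7. \<Sum>j<7. weights ! i * weights ! j * w0\<^sup>2) = (\<Sum>i<7. weights ! i)\<^sup>2 * w0\<^sup>2"
    unfolding power2_eq_square[of "sum _ _"] sum_product by (simp only: sum_distrib_right)
  moreover have "(\<Sum>i<7. weights ! i) = 6061"
    unfolding sum_lessThan_7 weights_nth by simp
  ultimately show ?thesis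
    by (simp add: has_bochner_integral_integral_eq w0_def power2_eq_square)
qed

theorem proposition4p2:
  shows "turan_constant (Omega (5/2)) \<ge> ereal ((559 + 80 * sqrt 42) / 506)
    \<and> (559 + 80 * sqrt 42) / 506 > (2::real)"
proof
  \<comment> \<open>The margin over the claimed bound is below \<open>0.001\<close>, so three exact decimals are used here.\<close>
  have "sqrt 42 \<le> 6481 / 1000"
    by (rule real_le_lsqrt) (auto simp: power2_eq_square)
  then have "(559 + 80 * sqrt 42) / 506 \<le> Re (LINT x|lborel. complex_of_real (test_fun x))"
    by (simp add: integral_test_fun w0_def)
  also have "ereal \<dots> \<le> turan_constant (Omega (5/2))"
    unfolding turan_constant_def by (rule SUP_upper[OF test_fun_in_turan_class])
  finally show "turan_constant (Omega (5/2)) \<ge> ereal ((559 + 80 * sqrt 42) / 506)"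
    by simp
  have "6 < sqrt 42"
    by (rule real_less_rsqrt) simp
  then show "(559 + 80 * sqrt 42) / 506 > (2::real)" by simp
qed

end
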